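(* Let $d\ge 1$ be an integer, let $\mathbb{T}^d=(\mathbb{R}/\mathbb{Z})^d$, let $\alpha\in\mathbb{T}^d$, and suppose that the shift $T:\mathbb{T}^d\to\mathbb{T}^d$, $T\omega=\omega+\alpha$, is minimal. Then $(\mathbb{T}^d,T)$ satisfies the global repetition property (GRP), and hence $(\mathbb{T}^d,T)$ also satisfies the topological repetition property (TRP) and $(\mathbb{T}^d,T,\mathrm{Leb})$ satisfies the metric repetition property (MRP), where $\mathrm{Leb}$ is normalized Lebesgue measure on $\mathbb{T}^d$.
   Context: $T$ is minimal if for every $\omega$ the orbit $\{T^n\omega:n\in\mathbb{Z}\}$ is dense. $\mathbb{T}^d$ carries its usual flat metric $\mathrm{dist}$ (the notions below do not depend on the choice of compatible metric, by compactness). Let $\Omega$ be a compact metric space and $T:\Omega\to\Omega$ a homeomorphism. A sequence $\{\omega_k\}_{k\ge 0}$ in $\Omega$ has the repetition property if for every $\varepsilon>0$ and $r>0$ there exists a positive integer $q$ such that $\mathrm{dist}(\omega_k,\omega_{k+q})<\varepsilon$ for $k=0,1,2,\ldots,\lfloor rq\rfloor$. Set $PRP(\Omega,T)=\{\omega\in\Omega : \{T^k\omega\}_{k\ge 0}\text{ has the repetition property}\}$. (TRP): $(\Omega,T)$ satisfies the topological repetition property if $PRP(\Omega,T)\ne\emptyset$. (MRP): for a $T$-ergodic Borel probability measure $\mu$, $(\Omega,T,\mu)$ satisfies the metric repetition property if $\mu(PRP(\Omega,T))>0$. (GRP): $(\Omega,T)$ satisfies the global repetition property if $PRP(\Omega,T)=\Omega$.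 *)

theory Defs
  imports "HOL-Probability.Probability"
begin

section \<open>The circle and the torus\<close>

quotient_type circle = real / "\<lambda>x y. x - y \<in> \<int>"
  morphisms rep_circle to_circle
proof (rule equivpI)
  show "reflp (\<lambda>x y::real. x - y \<in> \<int>)"
    by (simp add: reflp_def)
  show "symp (\<lambda>x y::real. x - y \<in> \<int>)"
    by (metis (no_types, lifting) Ints_minus minus_diff_eq sympI)
  show "transp (\<lambda>x y::real. x - y \<in> \<int>)"
  proof (rule transpI)
    fix x y z :: real
    assume "x - y \<in> \<int>" "y - z \<in> \<int>"
    then have "(x - y) + (y - z) \<in> \<int>" by (rule Ints_add)
    then show "x - z \<in> \<int>" by simp
  qed
qed

instantiation circle :: ab_group_add
begin

lift_definition zero_circle :: circle is 0 .

lift_definition plus_circle :: "circle \<Rightarrow> circle \<Rightarrow> circle" is "(+)"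
  by (metis Ints_add add_diff_add)

lift_definition uminus_circle :: "circle \<Rightarrow> circle" is uminus
  by (metis Ints_minus minus_diff_minus)

lift_definition minus_circle :: "circle \<Rightarrow> circle \<Rightarrow> circle" is "(-)"
  by (metis Ints_diff diff_diff_eq2 diff_add_eq add.commute diff_diff_eq)

instance
  by standard (transfer; simp)+

end

lemma infdist_Ints_attained:
  fixes x :: real
  obtains n where "n \<in> \<int>" "infdist x \<int> = \<bar>x - n\<bar>"
proof -
  have "\<exists>n\<in>\<int>. infdist x \<int> = dist x n"
    by (rule infdist_attains_inf[OF closed_Ints]) auto
  then show ?thesis using that by (auto simp: dist_real_def)
qed

lemma infdist_Ints_le:
  fixes x :: real
  assumes "n \<in> \<int>"
  shows "infdist x \<int> \<le> \<bar>x - n\<bar>"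
  using infdist_le[OF assms, of x] by (simp add: dist_real_def)

lemma infdist_Ints_cong_le:
  fixes x y :: real
  assumes "x - y \<in> \<int>"
  shows "infdist x \<int> \<le> infdist y \<int>"
proof -
  obtain n where n: "n \<in> \<int>" "infdist y \<int> = \<bar>y - n\<bar>"
    by (rule infdist_Ints_attained)
  have "infdist x \<int> \<le> \<bar>x - (n + (x - y))\<bar>"
    using n(1) assms by (intro infdist_Ints_le Ints_add)
  then show ?thesis using n(2) by (simp add: algebra_simps)
qed

lemma infdist_Ints_cong:
  fixes x y :: real
  assumes "x - y \<in> \<int>"
  shows "infdist x \<int> = infdist y \<int>"
  using infdist_Ints_cong_le[OF assms] infdist_Ints_cong_le[of y x] Ints_minus[OF assms]
  by simp

lemma infdist_Ints_minus:
  fixes x :: real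
  shows "infdist (- x) \<int> = infdist x \<int>"
proof -
  have "infdist (- y) \<int> \<le> infdist y \<int>" for y :: real
  proof -
    obtain n where n: "n \<in> \<int>" "infdist y \<int> = \<bar>y - n\<bar>"
      by (rule infdist_Ints_attained)
    have "infdist (- y) \<int> \<le> \<bar>- y - (- n)\<bar>"
      using n(1) by (intro infdist_Ints_le Ints_minus)
    then show ?thesis using n(2) by simp
  qed
  from this[of x] this[of "- x"] show ?thesis by simp
qed

lemma infdist_Ints_add_le:
  fixes x y :: real
  shows "infdist (x + y) \<int> \<le> infdist x \<int> + infdist y \<int>"
proof -
  obtain m where m: "m \<in> \<int>" "infdist x \<int> = \<bar>x - m\<bar>"
    by (rule infdist_Ints_attained)
  obtain n where n: "n \<in> \<int>" "infdist y \<int> = \<bar>y - n\<bar>"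
    by (rule infdist_Ints_attained)
  have "infdist (x + y) \<int> \<le> \<bar>(x + y) - (m + n)\<bar>"
    using m(1) n(1) by (intro infdist_Ints_le Ints_add)
  then show ?thesis using m(2) n(2) by linarith
qed

text \<open>The quotient metric on \<open>\<real>/\<int>\<close>: the distance of two classes is the minimum of
  \<open>\<bar>x - y - n\<bar>\<close> over integers \<open>n\<close>.\<close>

instantiation circle :: metric_space
begin

lift_definition dist_circle :: "circle \<Rightarrow> circle \<Rightarrow> real" is "\<lambda>x y. infdist (x - y) \<int>"
proof (rule infdist_Ints_cong)
  fix x x' y y' :: real
  assume "x - x' \<in> \<int>" "y - y' \<in> \<int>"
  then have "(x - x') - (y - y') \<in> \<int>" by (rule Ints_diff)
  then show "(x - y) - (x' - y') \<in> \<int>" by (simp add: algebra_simps)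
qed

definition uniformity_circle :: "(circle \<times> circle) filter" where
  "uniformity_circle = (INF e\<in>{0 <..}. principal {(x, y). dist x y < e})"

definition open_circle :: "circle set \<Rightarrow> bool" where
  "open_circle U \<longleftrightarrow> (\<forall>x\<in>U. \<forall>\<^sub>F (x', y) in uniformity. x' = x \<longrightarrow> y \<in> U)"

instance
proof
  fix x y z :: circle
  show "dist x y = 0 \<longleftrightarrow> x = y"
    by transfer (metis Ints_0 closed_Ints empty_iff in_closed_iff_infdist_zero)
  show "dist x y \<le> dist x z + dist y z"
  proof transfer
    fix x y z :: real
    show "infdist (x - y) \<int> \<le> infdist (x - z) \<int> + infdist (y - z) \<int>"
      using infdist_Ints_add_le[of "x - z" "z - y"] infdist_Ints_minus[of "y - z"] by simp
  qed
qed (simp_all only: uniformity_circle_def open_circle_def)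

end

text \<open>The metric which the library puts on \<^typ>\<open>circle ^ 'n\<close> is the Euclidean combination of
  the coordinate distances, that is, the flat metric of \<open>(\<real>/\<int>)\<^sup>d\<close> with \<open>d = CARD('n)\<close>.\<close>

type_synonym 'n torus = "circle ^ 'n"

definition torus_proj :: "real ^ 'n \<Rightarrow> 'n torus" where
  "torus_proj x = (\<chi> i. to_circle (x $ i))"

definition torus_shift :: "'n::finite torus \<Rightarrow> 'n torus \<Rightarrow> 'n torus" where
  "torus_shift \<alpha> \<omega> = \<omega> + \<alpha>"

text \<open>The unit cube is a fundamental domain of the lattice up to its faces, which are null sets.\<close>

definition torus_lebesgue :: "'n::finite torus measure" where
  "torus_lebesgue = distr (restrict_space lborel (cbox 0 1)) borel torus_proj"

lemma dist_to_circle_le: "dist (to_circle x) (to_circle y) \<le> \<bar>x - y\<bar>"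
proof -
  have "dist (to_circle x) (to_circle y) = infdist (x - y) \<int>"
    by transfer simp
  then show ?thesis using infdist_Ints_le[of 0 "x - y"] by simp
qed

lemma continuous_on_torus_proj: "continuous_on S (torus_proj :: real ^ 'n::finite \<Rightarrow> _)"
proof -
  have "dist (torus_proj x) (torus_proj y) \<le> dist x y" for x y :: "real ^ 'n"
    unfolding dist_vec_def torus_proj_def
    by (intro L2_set_mono) (simp_all add: dist_to_circle_le dist_real_def)
  then show ?thesis
    unfolding continuous_on_iff by (meson le_less_trans)
qed

lemma torus_proj_cbox: "torus_proj ` cbox 0 1 = (UNIV :: 'n::finite torus set)"
proof -
  have "\<exists>x\<in>cbox 0 1. torus_proj x = \<omega>" for \<omega> :: "'n torus"
  proof
    let ?x = "(\<chi> i. frac (rep_circle (\<omega> $ i))) :: real ^ 'n"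
    show "?x \<in> cbox 0 1"
      by (auto simp: mem_box_cart less_imp_le[OF frac_lt_1])
    have "to_circle (frac (rep_circle c)) = c" for c
    proof -
      have "to_circle (frac (rep_circle c)) = to_circle (rep_circle c)"
        unfolding circle.abs_eq_iff by (simp add: frac_def)
      then show ?thesis using Quotient3_abs_rep[OF Quotient3_circle] by simp
    qed
    then show "torus_proj ?x = \<omega>"
      by (simp add: torus_proj_def vec_eq_iff)
  qed
  then show ?thesis by (metis (no_types, lifting) UNIV_eq_I image_iff)
qed

lemma compact_torus: "compact (UNIV :: 'n::finite torus set)"
proof -
  have "compact ((torus_proj :: real ^ 'n \<Rightarrow> _) ` cbox 0 1)"
    by (rule compact_continuous_image[OF continuous_on_torus_proj compact_cbox])
  then show ?thesis by (simp add: torus_proj_cbox)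
qed

lemma homeomorphism_torus_shift:
  "homeomorphism UNIV UNIV (torus_shift \<alpha>) (torus_shift (- \<alpha>))"
proof -
  have "dist (a + c) (b + c) = dist a b" for a b c :: circle
    by transfer simp
  then have "dist (torus_shift \<beta> x) (torus_shift \<beta> y) = dist x y" for \<beta> x y
    by (simp add: dist_vec_def torus_shift_def)
  then have "continuous_on UNIV (torus_shift \<beta>)" for \<beta>
    unfolding continuous_on_iff by metis
  from this[of \<alpha>] this[of "- \<alpha>"] show ?thesis
    by (intro homeomorphismI) (auto simp: torus_shift_def)
qed

lemma sets_torus_lebesgue: "sets torus_lebesgue = sets borel"
  by (simp add: torus_lebesgue_def)

lemma prob_space_torus_lebesgue: "prob_space (torus_lebesgue :: 'n::finite torus measure)"
proof -
  let ?M = "restrict_space lborel (cbox 0 1) :: (real ^ 'n) measure"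
  have "(1 :: real ^ 'n) \<bullet> b = 1" if "b \<in> Basis" for b
    using that by (auto simp: Basis_vec_def inner_axis)
  then have "emeasure lborel (cbox 0 1 :: (real ^ 'n) set) = 1"
    by (simp add: emeasure_lborel_cbox_eq)
  then have "prob_space ?M"
    by (intro prob_spaceI) (simp add: emeasure_restrict_space space_restrict_space)
  moreover have "(torus_proj :: real ^ 'n \<Rightarrow> _) \<in> measurable ?M borel"
    by (intro measurable_restrict_space1) 
      (simp add: borel_measurable_continuous_onI continuous_on_torus_proj)
  ultimately show ?thesis
    unfolding torus_lebesgue_def by (rule prob_space.prob_space_distr)
qed

section \<open>Dynamics and repetition properties\<close>

definition int_iterate :: "'a set \<Rightarrow> ('a \<Rightarrow> 'a) \<Rightarrow> int \<Rightarrow> 'a \<Rightarrow> 'a" where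
  "int_iterate \<Omega> T n = (if 0 \<le> n then T ^^ nat n else inv_into \<Omega> T ^^ nat (- n))"

definition minimal_on :: "'a::metric_space set \<Rightarrow> ('a \<Rightarrow> 'a) \<Rightarrow> bool" where
  "minimal_on \<Omega> T \<longleftrightarrow> (\<forall>\<omega>\<in>\<Omega>. \<Omega> \<subseteq> closure (range (\<lambda>n::int. int_iterate \<Omega> T n \<omega>)))"

definition ergodic_measure :: "'a::metric_space set \<Rightarrow> ('a \<Rightarrow> 'a) \<Rightarrow> 'a measure \<Rightarrow> bool" where
  "ergodic_measure \<Omega> T \<mu> \<longleftrightarrow>
     prob_space \<mu> \<and> sets \<mu> = sets (restrict_space borel \<Omega>) \<and>
     T \<in> measurable \<mu> \<mu> \<and> distr \<mu> \<mu> T = \<mu> \<and>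
     (\<forall>A\<in>sets \<mu>. T -` A \<inter> space \<mu> = A \<longrightarrow> measure \<mu> A = 0 \<or> measure \<mu> A = 1)"

definition repetition_property :: "(nat \<Rightarrow> 'a::metric_space) \<Rightarrow> bool" where
  "repetition_property \<omega> \<longleftrightarrow>
     (\<forall>\<epsilon>>0. \<forall>r>0. \<exists>q>0. \<forall>k \<le> nat \<lfloor>r * real q\<rfloor>. dist (\<omega> k) (\<omega> (k + q)) < \<epsilon>)"

definition PRP :: "'a::metric_space set \<Rightarrow> ('a \<Rightarrow> 'a) \<Rightarrow> 'a set" where
  "PRP \<Omega> T = {\<omega>\<in>\<Omega>. repetition_property (\<lambda>k. (T ^^ k) \<omega>)}"

definition TRP :: "'a::metric_space set \<Rightarrow> ('a \<Rightarrow> 'a) \<Rightarrow> bool" where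
  "TRP \<Omega> T \<longleftrightarrow> PRP \<Omega> T \<noteq> {}"

text \<open>The metric repetition property is only meaningful for ergodic measures, so ergodicity is
  part of the predicate. Since a non-measurable set has \<^const>\<open>measure\<close> zero, the positivity
  condition includes measurability of \<^term>\<open>PRP \<Omega> T\<close>.\<close>

definition MRP :: "'a::metric_space set \<Rightarrow> ('a \<Rightarrow> 'a) \<Rightarrow> 'a measure \<Rightarrow> bool" where
  "MRP \<Omega> T \<mu> \<longleftrightarrow> ergodic_measure \<Omega> T \<mu> \<and> measure \<mu> (PRP \<Omega> T) > 0"

definition GRP :: "'a::metric_space set \<Rightarrow> ('a \<Rightarrow> 'a) \<Rightarrow> bool" where
  "GRP \<Omega> T \<longleftrightarrow> PRP \<Omega> T = \<Omega>"

end

theory Submission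
  imports Defs
begin

text \<open>The orbit of \<open>0\<close> has a convergent subsequence because the torus is compact, so two of its
  points \<open>T\<^sup>i 0\<close> and \<open>T\<^sup>j 0\<close> with \<open>i < j\<close> are within \<open>\<epsilon>\<close>. Translations are isometries that commute
  with \<open>T\<close>; hence with \<open>q = j - i\<close> every point of the torus lies within \<open>\<epsilon>\<close> of its image under
  \<open>T\<^sup>q\<close> (\<open>torus_shift_almost_period\<close>). One \<open>q\<close> therefore serves every starting point and every time
  \<open>k\<close>, whatever \<open>r\<close> is. This is the global repetition property. The topological one follows at
  once, and so does the positivity in the metric one, since the set in question is the whole torus.

  What remains is that Lebesgue measure is an ergodic invariant measure. Both parts are proved by
  lifting sets from the torus to \<open>\<real>\<^sup>d\<close>. For invariance, the torus measure of a set is the volume of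
  its periodic lift inside a unit cube, and this volume does not depend on where the cube sits
  (\<open>emeasure_periodic_lattice_cell\<close>): two half-open cubes are cut by the integer translates of each
  other into the same pieces.

  For ergodicity, minimality says that the lift of an invariant set is preserved by a dense set of
  translations of \<open>\<real>\<^sup>d\<close>. A Borel set \<open>B\<close> with this property is null or has null complement
  (\<open>null_or_conull_if_dense_translations\<close>). Indeed, approximation by open and closed sets carries the
  invariance from the dense set to all translations \<open>t\<close>, up to null sets: almost no \<open>x \<in> B\<close> has
  \<open>x + t \<notin> B\<close>. By Fubini, the null set of pairs \<open>(x, t)\<close> with \<open>x \<in> B\<close> and \<open>x + t \<notin> B\<close> has
  measure \<open>\<lambda>(B) \<lambda>(- B)\<close>.\<close>

section \<open>Borel sets preserved by a dense set of translations\<close>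

lemma emeasure_lborel_translate:
  fixes S :: "'a::euclidean_space set"
  assumes "S \<in> sets borel"
  shows "emeasure lborel {x. c + x \<in> S} = emeasure lborel S"
proof -
  have "emeasure lborel S = emeasure (distr lborel borel ((+) c)) S"
    by (simp only: lborel_distr_plus)
  also have "\<dots> = emeasure lborel {x. c + x \<in> S}"
    using assms by (simp add: emeasure_distr vimage_def)
  finally show ?thesis by simp
qed

text \<open>Let \<open>F \<subseteq> B \<inter> C\<close> be compact and \<open>U \<supseteq> B\<close> open, both with small error. Then \<open>F\<close> has positive
  distance from the complement of \<open>U\<close>, so if \<open>g\<close> preserves \<open>B\<close> and is close to \<open>t\<close>, the translate
  \<open>F + (t - g)\<close> stays in \<open>U\<close>. A point \<open>x \<in> F\<close> can leave \<open>B\<close> under \<open>t\<close> only if \<open>x + (t - g)\<close> lies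
  in the small set \<open>U - B\<close>. The compact \<open>C\<close> makes \<open>F\<close> compact.\<close>

lemma null_translation_defect:
  fixes B C :: "'a::euclidean_space set"
  assumes B: "B \<in> sets borel" and C: "compact C"
    and dense: "closure {g. \<forall>x. x + g \<in> B \<longleftrightarrow> x \<in> B} = UNIV"
  shows "emeasure lborel {x \<in> B \<inter> C. x + t \<notin> B} = 0"
proof -
  have small: "emeasure lborel {x \<in> B \<inter> C. x + t \<notin> B} \<le> 0 + ennreal e" if "e > 0" for e :: real
  proof -
    have e2: "e / 2 > 0" using that by simp
    have BC: "B \<inter> C \<in> sets borel"
      by (intro sets.Int B borel_compact C)
    have lB: "B \<in> sets lebesgue" and lBC: "B \<inter> C \<in> sets lebesgue"
      using B BC by (simp_all add: sets_completionI_sets)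
    obtain U where U: "open U" "B \<subseteq> U" "U - B \<in> lmeasurable" "emeasure lebesgue (U - B) < ennreal (e / 2)"
      by (rule sets_lebesgue_outer_open[OF lB e2])
    obtain F where F: "closed F" "F \<subseteq> B \<inter> C" "B \<inter> C - F \<in> lmeasurable"
        "emeasure lebesgue (B \<inter> C - F) < ennreal (e / 2)"
      by (rule sets_lebesgue_inner_closed[OF lBC e2])
    have UB: "U - B \<in> sets borel" and BCF: "B \<inter> C - F \<in> sets borel"
      using U(1) F(1) B BC by auto
    have UBt: "{x. (t - g) + x \<in> U - B} \<in> sets borel" for g
    proof -
      have "(\<lambda>x. (t - g) + x) -` (U - B) \<inter> space borel \<in> sets borel"
        by (rule measurable_sets[OF _ UB]) simp
      then show ?thesis by (simp add: vimage_def)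
    qed
    have "compact F"
      using compact_Int_closed[OF C F(1)] F(2) by (simp add: Int_absorb1)
    moreover have "F \<inter> - U = {}" using F(2) U(2) by auto
    ultimately obtain d where d: "d > 0" "\<And>x y. x \<in> F \<Longrightarrow> y \<in> - U \<Longrightarrow> d \<le> dist x y"
      using separate_compact_closed[of F "- U"] U(1) by (meson closed_Compl)
    have "t \<in> closure {g. \<forall>x. x + g \<in> B \<longleftrightarrow> x \<in> B}"
      using dense by simp
    then have "\<exists>g\<in>{g. \<forall>x. x + g \<in> B \<longleftrightarrow> x \<in> B}. dist g t < d"
      using d(1) by (simp only: closure_approachable)
    then obtain g where g: "\<forall>x. x + g \<in> B \<longleftrightarrow> x \<in> B" "dist g t < d"
      by (elim bexE CollectE)
    have "x + t \<in> B" if "x \<in> F" "(t - g) + x \<notin> U - B" for x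
    proof -
      have "dist x ((t - g) + x) < d"
        using g(2) by (simp add: dist_norm norm_minus_commute)
      then have "(t - g) + x \<in> B"
        using d(2)[OF that(1), of "(t - g) + x"] that(2) by force
      then show ?thesis
        using g(1)[rule_format, of "(t - g) + x"] by (simp add: algebra_simps)
    qed
    then have "{x \<in> B \<inter> C. x + t \<notin> B} \<subseteq> (B \<inter> C - F) \<union> {x. (t - g) + x \<in> U - B}"
      by blast
    then have "emeasure lborel {x \<in> B \<inter> C. x + t \<notin> B}
        \<le> emeasure lborel ((B \<inter> C - F) \<union> {x. (t - g) + x \<in> U - B})"
      using BCF UBt[of g] by (intro emeasure_mono sets.Un) (simp_all only: sets_lborel)
    also have "\<dots> \<le> emeasure lborel (B \<inter> C - F) + emeasure lborel {x. (t - g) + x \<in> U - B}"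
      using BCF UBt[of g] by (intro emeasure_subadditive) (simp_all only: sets_lborel)
    also have "\<dots> = emeasure lborel (B \<inter> C - F) + emeasure lborel (U - B)"
      by (simp only: emeasure_lborel_translate[OF UB])
    also have "\<dots> \<le> ennreal (e / 2) + ennreal (e / 2)"
      using U(4) F(4) UB BCF by (intro add_mono) (simp_all add: less_imp_le)
    also have "\<dots> = 0 + ennreal e"
      using that by (simp flip: ennreal_plus)
    finally show ?thesis .
  qed
  have "emeasure lborel {x \<in> B \<inter> C. x + t \<notin> B} \<le> 0"
    by (rule ennreal_le_epsilon) (rule small)
  then show ?thesis by simp
qed

lemma null_compact_part_or_conull:
  fixes B C :: "'a::euclidean_space set"
  assumes B: "B \<in> sets borel" and C: "compact C"
    and dense: "closure {g. \<forall>x. x + g \<in> B \<longleftrightarrow> x \<in> B} = UNIV"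
  shows "emeasure lborel (B \<inter> C) = 0 \<or> emeasure lborel (- B) = 0"
proof -
  have [measurable]: "B \<in> sets borel" "B \<inter> C \<in> sets borel" "- B \<in> sets borel"
    using B C by (auto intro: borel_compact)
  \<comment> \<open>Integrating first over \<open>x\<close> gives \<open>0\<close>, integrating first over \<open>t\<close> gives the product of the two
    measures.\<close>
  let ?f = "\<lambda>(x, t). indicator (B \<inter> C) x * indicator (- B) (x + t) :: ennreal"
  have meas: "?f \<in> borel_measurable (lborel \<Otimes>\<^sub>M lborel)"
    by measurable
  have "(\<integral>\<^sup>+ t. (\<integral>\<^sup>+ x. ?f (x, t) \<partial>lborel) \<partial>lborel)
      = (\<integral>\<^sup>+ t. emeasure lborel {x \<in> B \<inter> C. x + t \<notin> B} \<partial>lborel)"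
  proof (intro nn_integral_cong)
    fix t :: 'a
    have [measurable]: "{x \<in> B \<inter> C. x + t \<notin> B} \<in> sets lborel"
      by measurable
    have "(\<integral>\<^sup>+ x. ?f (x, t) \<partial>lborel)
        = (\<integral>\<^sup>+ x. indicator {x \<in> B \<inter> C. x + t \<notin> B} x \<partial>lborel)"
      by (intro nn_integral_cong) (auto simp: indicator_def)
    also have "\<dots> = emeasure lborel {x \<in> B \<inter> C. x + t \<notin> B}"
      by (intro nn_integral_indicator) measurable
    finally show "(\<integral>\<^sup>+ x. ?f (x, t) \<partial>lborel) = emeasure lborel {x \<in> B \<inter> C. x + t \<notin> B}" .
  qed
  also have "\<dots> = 0"
    by (simp only: null_translation_defect[OF B C dense]) simp
  finally have "(\<integral>\<^sup>+ x. (\<integral>\<^sup>+ t. ?f (x, t) \<partial>lborel) \<partial>lborel) = 0"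
    using lborel_pair.Fubini'[of "\<lambda>x t. ?f (x, t)"] meas by simp
  moreover have "(\<integral>\<^sup>+ t. ?f (x, t) \<partial>lborel) = indicator (B \<inter> C) x * emeasure lborel (- B)" for x
  proof -
    have "(\<integral>\<^sup>+ t. indicator (- B) (x + t) \<partial>lborel) = emeasure lborel (- B)"
    proof -
      have "(\<integral>\<^sup>+ t. indicator (- B) (x + t) \<partial>lborel)
          = (\<integral>\<^sup>+ t. indicator {t. x + t \<in> - B} t \<partial>lborel)"
        by (intro nn_integral_cong) (auto simp: indicator_def)
      also have "\<dots> = emeasure lborel {t. x + t \<in> - B}"
        by (intro nn_integral_indicator) measurable
      also have "\<dots> = emeasure lborel (- B)"
        by (intro emeasure_lborel_translate) measurable
      finally show ?thesis .
    qed
    then show ?thesis by (simp add: nn_integral_cmult)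
  qed
  ultimately have "emeasure lborel (B \<inter> C) * emeasure lborel (- B) = 0"
    by (simp add: nn_integral_multc)
  then show ?thesis by simp
qed

theorem null_or_conull_if_dense_translations:
  fixes B :: "'a::euclidean_space set"
  assumes B: "B \<in> sets borel"
    and dense: "closure {g. \<forall>x. x + g \<in> B \<longleftrightarrow> x \<in> B} = UNIV"
  shows "B \<in> null_sets lborel \<or> - B \<in> null_sets lborel"
proof (cases "emeasure lborel (- B) = 0")
  case True
  then show ?thesis using B by (simp add: null_sets_def)
next
  case False
  have "B \<inter> cball 0 (real n) \<in> null_sets lborel" for n
    using null_compact_part_or_conull[OF B compact_cball dense, of 0 "real n"] False B
    by (simp add: null_sets_def)
  then have "(\<Union>n. B \<inter> cball 0 (real n)) \<in> null_sets lborel"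
    by (rule null_sets_UN)
  moreover have "(\<Union>n. B \<inter> cball 0 (real n)) = B"
    using real_arch_simple by auto
  ultimately show ?thesis by simp
qed

section \<open>Translation invariance of Lebesgue measure on the torus\<close>

text \<open>For fixed \<open>a\<close>, these are the half-open unit cubes with corners in \<open>a + \<int>\<^sup>d\<close>. Labelling each by
  the integer parts of the coordinates relative to \<open>a\<close> makes them a partition by construction.\<close>

definition lattice_cell :: "real ^ 'n \<Rightarrow> ('n \<Rightarrow> int) \<Rightarrow> (real ^ 'n) set" where
  "lattice_cell a m = {x. \<forall>i. \<lfloor>x $ i - a $ i\<rfloor> = m i}"

lemma sets_lattice_cell [measurable]: "lattice_cell (a :: real ^ 'n::finite) m \<in> sets borel"
  unfolding lattice_cell_def by measurable

lemma emeasure_partition_lattice_cell: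
  fixes S :: "(real ^ 'n::finite) set"
  assumes "S \<in> sets borel"
  shows "emeasure lborel S = (\<integral>\<^sup>+ m. emeasure lborel (S \<inter> lattice_cell a m) \<partial>count_space UNIV)"
proof -
  have "x \<in> lattice_cell a (\<lambda>i. \<lfloor>x $ i - a $ i\<rfloor>)" for x
    by (simp add: lattice_cell_def)
  then have cover: "(\<Union>m. S \<inter> lattice_cell a m) = S"
    by blast
  have "disjoint_family (\<lambda>m. S \<inter> lattice_cell a m)"
    by (auto simp: disjoint_family_on_def lattice_cell_def)
  then have "emeasure lborel (\<Union>m. S \<inter> lattice_cell a m)
      = (\<integral>\<^sup>+ m. emeasure lborel (S \<inter> lattice_cell a m) \<partial>count_space UNIV)"
    using assms by (intro emeasure_UN_countable) simp_all
  then show ?thesis by (simp only: cover)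
qed

text \<open>Cut the cube at \<open>a\<close> along the grid of \<open>b\<close>. The integer translation that moves the grid cell
  \<open>m\<close> of \<open>b\<close> to the cell \<open>0\<close> moves the piece in that cell to the piece of the cube at \<open>b\<close> in the cell
  \<open>- m\<close> of the grid of \<open>a\<close>. So the two cubes have the same pieces up to integer translations.\<close>

lemma emeasure_periodic_lattice_cell:
  fixes B :: "(real ^ 'n::finite) set"
  assumes B: "B \<in> sets borel"
    and periodic: "\<And>x v. (\<And>i. v $ i \<in> \<int>) \<Longrightarrow> v + x \<in> B \<longleftrightarrow> x \<in> B"
  shows "emeasure lborel (B \<inter> lattice_cell a (\<lambda>_. 0)) = emeasure lborel (B \<inter> lattice_cell b (\<lambda>_. 0))"
proof -
  let ?Q = "\<lambda>a m. lattice_cell a m :: (real ^ 'n) set" and ?z = "\<lambda>_::'n. 0 :: int"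
  have swap: "emeasure lborel (B \<inter> ?Q a ?z \<inter> ?Q b m) = emeasure lborel (B \<inter> ?Q b ?z \<inter> ?Q a (- m))" for m
  proof -
    let ?v = "(\<chi> i. of_int (m i)) :: real ^ 'n"
    have fl: "\<lfloor>real_of_int k + y - z\<rfloor> = k + \<lfloor>y - z\<rfloor>" for k y z
      by linarith
    have "?v + x \<in> B \<longleftrightarrow> x \<in> B" for x
      by (rule periodic) simp
    then have "{x. ?v + x \<in> B \<inter> ?Q a ?z \<inter> ?Q b m} = B \<inter> ?Q b ?z \<inter> ?Q a (- m)"
      by (auto simp: lattice_cell_def fl add_eq_0_iff)
    then show ?thesis
      using emeasure_lborel_translate[of "B \<inter> ?Q a ?z \<inter> ?Q b m" ?v] B by simp
  qed
  have "emeasure lborel (B \<inter> ?Q a ?z)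
      = (\<integral>\<^sup>+ m. emeasure lborel (B \<inter> ?Q a ?z \<inter> ?Q b m) \<partial>count_space UNIV)"
    using B by (intro emeasure_partition_lattice_cell) simp
  also have "\<dots> = (\<integral>\<^sup>+ m. emeasure lborel (B \<inter> ?Q b ?z \<inter> ?Q a (- m)) \<partial>count_space UNIV)"
    by (simp only: swap)
  also have "\<dots> = (\<integral>\<^sup>+ m. emeasure lborel (B \<inter> ?Q b ?z \<inter> ?Q a m) \<partial>count_space UNIV)"
    by (intro nn_integral_bij_count_space[where g = uminus])
      (rule o_bij[of uminus], simp_all add: fun_eq_iff)
  also have "\<dots> = emeasure lborel (B \<inter> ?Q b ?z)"
    using B by (intro emeasure_partition_lattice_cell[symmetric]) simp
  finally show ?thesis .
qed

lemma torus_proj_add: "torus_proj (x + y) = torus_proj x + torus_proj y"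
  by (simp add: torus_proj_def vec_eq_iff plus_circle.abs_eq)

lemma torus_proj_eq_0: "(\<And>i. v $ i \<in> \<int>) \<Longrightarrow> torus_proj v = 0"
  by (simp add: torus_proj_def vec_eq_iff zero_circle_def circle.abs_eq_iff)

lemma borel_torus_proj [measurable]: "torus_proj \<in> borel_measurable (borel :: (real ^ 'n::finite) measure)"
  by (rule borel_measurable_continuous_onI[OF continuous_on_torus_proj])

lemma torus_proj_vimage_borel:
  "A \<in> sets borel \<Longrightarrow> torus_proj -` A \<in> sets (borel :: (real ^ 'n::finite) measure)"
  using measurable_sets[OF borel_torus_proj, of A] by simp

lemma emeasure_torus_lebesgue:
  fixes A :: "'n::finite torus set"
  assumes "A \<in> sets borel"
  shows "emeasure torus_lebesgue A = emeasure lborel (torus_proj -` A \<inter> cbox 0 1)"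
proof -
  have "torus_proj \<in> measurable (restrict_space lborel (cbox 0 1)) (borel :: 'n torus measure)"
    by (intro measurable_restrict_space1) simp
  then have "emeasure torus_lebesgue A
      = emeasure (restrict_space lborel (cbox 0 1)) (torus_proj -` A \<inter> cbox 0 1)"
    unfolding torus_lebesgue_def using assms by (subst emeasure_distr) (simp_all add: space_restrict_space)
  also have "\<dots> = emeasure lborel (torus_proj -` A \<inter> cbox 0 1)"
    by (intro emeasure_restrict_space) simp_all
  finally show ?thesis .
qed

text \<open>The measure is defined by the closed cube at the origin, whose faces are null. The freedom in
  the choice of \<open>a\<close> is what makes translation invariance visible: a translation of the torus only
  changes the cell over which a lift is measured.\<close>

lemma emeasure_torus_lebesgue_cell:
  fixes A :: "'n::finite torus set"
  assumes "A \<in> sets borel"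
  shows "emeasure torus_lebesgue A = emeasure lborel (torus_proj -` A \<inter> lattice_cell a (\<lambda>_. 0))"
proof -
  let ?B = "torus_proj -` A :: (real ^ 'n) set"
  have B: "?B \<in> sets borel"
    using assms by (rule torus_proj_vimage_borel)
  let ?Q = "lattice_cell 0 (\<lambda>_. 0) :: (real ^ 'n) set"
  have Q: "box 0 1 \<subseteq> ?Q" "?Q \<subseteq> cbox 0 1"
    by (auto simp: lattice_cell_def mem_box_cart floor_eq_iff less_imp_le)
  have "cbox 0 1 - box 0 1 \<in> null_sets (lborel :: (real ^ 'n) measure)"
    by (intro null_setsI) (auto simp: emeasure_Diff emeasure_lborel_box_eq emeasure_lborel_cbox_eq box_subset_cbox)
  then have "AE x in lborel. x \<notin> cbox 0 1 - (box 0 1 :: (real ^ 'n) set)"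
    by (rule AE_not_in)
  then have "emeasure lborel (?B \<inter> cbox 0 1) = emeasure lborel (?B \<inter> ?Q)"
    using B Q by (intro emeasure_eq_AE) (auto elim!: eventually_mono)
  also have "\<dots> = emeasure lborel (?B \<inter> lattice_cell a (\<lambda>_. 0))"
    using B by (intro emeasure_periodic_lattice_cell) (simp_all add: torus_proj_add torus_proj_eq_0)
  finally show ?thesis
    using emeasure_torus_lebesgue[OF assms] by simp
qed

lemma measurable_torus_shift [measurable]: "torus_shift \<alpha> \<in> borel_measurable borel"
  using homeomorphism_torus_shift[of \<alpha>]
  by (intro borel_measurable_continuous_onI) (simp add: homeomorphism_def)

lemma distr_torus_shift: "distr torus_lebesgue torus_lebesgue (torus_shift \<alpha>) = torus_lebesgue"
proof (rule measure_eqI)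
  fix A assume "A \<in> sets (distr torus_lebesgue torus_lebesgue (torus_shift \<alpha>))"
  then have A: "A \<in> sets borel" by (simp add: sets_torus_lebesgue)
  obtain a where a: "torus_proj a = \<alpha>"
    using torus_proj_cbox by (metis UNIV_I imageE)
  have TA: "torus_shift \<alpha> -` A \<in> sets borel"
    using measurable_sets[OF measurable_torus_shift A] by simp
  have "emeasure (distr torus_lebesgue torus_lebesgue (torus_shift \<alpha>)) A
      = emeasure torus_lebesgue (torus_shift \<alpha> -` A)"
    using A by (subst emeasure_distr)
      (simp_all add: sets_torus_lebesgue torus_lebesgue_def cong: measurable_cong_sets)
  also have "\<dots> = emeasure lborel (torus_proj -` torus_shift \<alpha> -` A \<inter> lattice_cell 0 (\<lambda>_. 0))"
    by (rule emeasure_torus_lebesgue_cell[OF TA])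
  also have "torus_proj -` torus_shift \<alpha> -` A \<inter> lattice_cell 0 (\<lambda>_. 0)
      = {x. a + x \<in> torus_proj -` A \<inter> lattice_cell a (\<lambda>_. 0)}"
    by (auto simp: torus_shift_def torus_proj_add a lattice_cell_def add.commute)
  also have "emeasure lborel \<dots> = emeasure lborel (torus_proj -` A \<inter> lattice_cell a (\<lambda>_. 0))"
    using torus_proj_vimage_borel[OF A] by (intro emeasure_lborel_translate) simp
  also have "\<dots> = emeasure torus_lebesgue A"
    by (rule emeasure_torus_lebesgue_cell[OF A, symmetric])
  finally show "emeasure (distr torus_lebesgue torus_lebesgue (torus_shift \<alpha>)) A
      = emeasure torus_lebesgue A" .
qed simp

section \<open>Ergodicity of minimal shifts\<close>

text \<open>This turns density in the torus into density of the lifted translations.\<close>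

lemma obtain_nearest_lift:
  fixes x :: "real ^ 'n::finite"
  obtains y where "torus_proj y = \<omega>" "dist y x = dist \<omega> (torus_proj x)"
proof -
  have lift: "\<exists>r. to_circle r = c \<and> \<bar>r - s\<bar> = dist c (to_circle s)" for c s
  proof -
    obtain u where u: "to_circle u = c"
      using Quotient3_abs_rep[OF Quotient3_circle] by blast
    obtain n where n: "n \<in> \<int>" "infdist (u - s) \<int> = \<bar>(u - s) - n\<bar>"
      by (rule infdist_Ints_attained)
    have "to_circle (u - n) = c"
      using n(1) u Ints_minus[OF n(1)] by (auto simp: circle.abs_eq_iff)
    moreover have "\<bar>(u - n) - s\<bar> = dist c (to_circle s)"
      using n(2) by (simp add: dist_circle.abs_eq algebra_simps flip: u)
    ultimately show ?thesis by blast
  qed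
  have "\<exists>f. \<forall>i. to_circle (f i) = \<omega> $ i \<and> \<bar>f i - x $ i\<bar> = dist (\<omega> $ i) (to_circle (x $ i))"
    by (intro choice allI lift)
  then obtain f where f: "\<And>i. to_circle (f i) = \<omega> $ i"
      "\<And>i. \<bar>f i - x $ i\<bar> = dist (\<omega> $ i) (to_circle (x $ i))"
    by blast
  show ?thesis
    by (rule that[of "\<chi> i. f i"])
      (simp_all add: f torus_proj_def vec_eq_iff dist_vec_def dist_real_def)
qed

lemma torus_shift_funpow: "(torus_shift \<alpha> ^^ n) \<omega> = (torus_shift \<alpha> ^^ n) 0 + \<omega>"
  by (induction n) (simp_all add: torus_shift_def algebra_simps)

lemma inv_torus_shift: "inv (torus_shift \<alpha>) = torus_shift (- \<alpha>)"
  by (rule inv_unique_comp) (auto simp: torus_shift_def)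

lemma int_iterate_torus_shift:
  "int_iterate UNIV (torus_shift \<alpha>) n \<omega> = int_iterate UNIV (torus_shift \<alpha>) n 0 + \<omega>"
  using torus_shift_funpow[of _ \<alpha> \<omega>] torus_shift_funpow[of _ "- \<alpha>" \<omega>]
  by (simp add: int_iterate_def inv_torus_shift)

lemma funpow_mem_iff_invariant:
  assumes "f -` A = A"
  shows "(f ^^ n) x \<in> A \<longleftrightarrow> x \<in> A"
  using assms by (induction n) auto

lemma int_iterate_mem_iff_invariant:
  assumes "torus_shift \<alpha> -` A = A"
  shows "int_iterate UNIV (torus_shift \<alpha>) n \<omega> \<in> A \<longleftrightarrow> \<omega> \<in> A"
proof -
  have "torus_shift (- \<alpha>) -` A = A"
  proof -
    have "x - \<alpha> \<in> A \<longleftrightarrow> x \<in> A" for x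
      using assms[unfolded set_eq_iff, rule_format, of "x - \<alpha>"] by (simp add: torus_shift_def)
    then show ?thesis by (simp add: torus_shift_def vimage_def)
  qed
  with assms show ?thesis
    by (simp add: int_iterate_def inv_torus_shift funpow_mem_iff_invariant)
qed

text \<open>Minimality enters through the orbit of \<open>0\<close> alone: the lifts of its points are translations
  that preserve the lift of every invariant set.\<close>

lemma ergodic_torus_lebesgue:
  fixes \<alpha> :: "'n::finite torus"
  assumes minimal: "minimal_on UNIV (torus_shift \<alpha>)"
  shows "ergodic_measure UNIV (torus_shift \<alpha>) torus_lebesgue"
proof -
  let ?T = "torus_shift \<alpha>"
  interpret prob_space "torus_lebesgue :: 'n torus measure"
    by (rule prob_space_torus_lebesgue)
  have space: "space torus_lebesgue = (UNIV :: 'n torus set)"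
    by (simp add: torus_lebesgue_def)
  have "prob A = 0 \<or> prob A = 1" if "A \<in> sets torus_lebesgue" and inv: "?T -` A = A" for A
  proof -
    have A: "A \<in> sets borel"
      using that by (simp add: sets_torus_lebesgue)
    let ?B = "torus_proj -` A :: (real ^ 'n) set"
    have "\<exists>g. (\<forall>x. x + g \<in> ?B \<longleftrightarrow> x \<in> ?B) \<and> dist g t < e" if "e > 0" for t e
    proof -
      have "torus_proj t \<in> closure (range (\<lambda>n. int_iterate UNIV ?T n 0))"
        using minimal by (auto simp: minimal_on_def)
      then obtain n where n: "dist (int_iterate UNIV ?T n 0) (torus_proj t) < e"
        using \<open>e > 0\<close> unfolding closure_approachable by blast
      obtain g where g: "torus_proj g = int_iterate UNIV ?T n 0"
          "dist g t = dist (int_iterate UNIV ?T n 0) (torus_proj t)"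
        by (rule obtain_nearest_lift)
      have "x + g \<in> ?B \<longleftrightarrow> x \<in> ?B" for x
        using int_iterate_mem_iff_invariant[OF inv, of n "torus_proj x"]
          int_iterate_torus_shift[of \<alpha> n "torus_proj x"]
        by (simp add: torus_proj_add g(1) add.commute)
      with g(2) n show ?thesis by (intro exI[of _ g]) simp
    qed
    then have "closure {g. \<forall>x. x + g \<in> ?B \<longleftrightarrow> x \<in> ?B} = UNIV"
      by (auto simp: closure_approachable)
    from null_or_conull_if_dense_translations[OF torus_proj_vimage_borel[OF A] this]
    consider "?B \<in> null_sets lborel" | "- ?B \<in> null_sets lborel"
      by blast
    then show ?thesis
    proof cases
      case 1
      then have "prob A = 0"
        using emeasure_torus_lebesgue[OF A] by (simp add: measure_def null_setsD1 null_set_Int2)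
      then show ?thesis ..
    next
      case 2
      have cA: "- A \<in> sets borel" using A by simp
      have "torus_proj -` (- A) = - ?B" by auto
      then have "prob (- A) = 0"
        using 2 emeasure_torus_lebesgue[OF cA] by (simp add: measure_def null_setsD1 null_set_Int2)
      then show ?thesis
        using prob_compl[of A] that(1) by (simp add: space Compl_eq_Diff_UNIV)
    qed
  qed
  then show ?thesis
    unfolding ergodic_measure_def
    by (simp add: prob_space_axioms sets_torus_lebesgue distr_torus_shift space
        measurable_cong_sets[OF sets_torus_lebesgue sets_torus_lebesgue])
qed

section \<open>Almost periods of shifts\<close>

lemma dist_torus_add_right: "dist (x + z) (y + z) = dist x (y :: 'n::finite torus)"
proof -
  have "dist (a + c) (b + c) = dist a b" for a b c :: circle
    by transfer simp
  then show ?thesis by (simp add: dist_vec_def)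
qed

text \<open>Pigeonhole in a compact group: the almost period is a difference of two times at which the
  orbit of \<open>0\<close> nearly agrees.\<close>

lemma torus_shift_almost_period:
  fixes \<alpha> :: "'n::finite torus"
  assumes "\<epsilon> > 0"
  shows "\<exists>q>0. \<forall>\<omega>. dist \<omega> ((torus_shift \<alpha> ^^ q) \<omega>) < \<epsilon>"
proof -
  let ?x = "\<lambda>n. (torus_shift \<alpha> ^^ n) 0"
  obtain l s where s: "strict_mono s" "(?x \<circ> s) \<longlonglongrightarrow> l"
    using compact_torus[where 'n = 'n] unfolding compact_eq_seq_compact_metric seq_compact_def
    by (metis UNIV_I)
  then have "Cauchy (?x \<circ> s)"
    by (simp add: LIMSEQ_imp_Cauchy)
  then obtain N where N: "\<forall>m\<ge>N. \<forall>n\<ge>N. dist (?x (s m)) (?x (s n)) < \<epsilon>"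
    using assms unfolding Cauchy_def comp_def by blast
  define q where "q = s (Suc N) - s N"
  have less: "s N < s (Suc N)"
    using s(1) by (simp add: strict_mono_def)
  have "?x (s (Suc N)) = (torus_shift \<alpha> ^^ q) (?x (s N))"
    using less by (simp add: q_def flip: funpow_add[THEN fun_cong, unfolded comp_def])
  also have "\<dots> = ?x q + ?x (s N)"
    by (rule torus_shift_funpow)
  finally have "dist 0 (?x q) < \<epsilon>"
    using N[rule_format, of N "Suc N"] dist_torus_add_right[of 0 "?x (s N)" "?x q"] by simp
  then have "dist \<omega> ((torus_shift \<alpha> ^^ q) \<omega>) < \<epsilon>" for \<omega>
    using torus_shift_funpow[of q \<alpha> \<omega>] dist_torus_add_right[of 0 \<omega> "?x q"] by simp
  moreover have "q > 0" using less by (simp add: q_def)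
  ultimately show ?thesis by blast
qed

lemma GRP_torus_shift: "GRP UNIV (torus_shift (\<alpha> :: 'n::finite torus))"
proof -
  have "repetition_property (\<lambda>k. (torus_shift \<alpha> ^^ k) \<omega>)" for \<omega>
    unfolding repetition_property_def
  proof (intro allI impI)
    fix \<epsilon> r :: real assume "\<epsilon> > 0"
    then obtain q where q: "q > 0" "\<And>\<omega>. dist \<omega> ((torus_shift \<alpha> ^^ q) \<omega>) < \<epsilon>"
      using torus_shift_almost_period[of \<epsilon> \<alpha>] by blast
    have "(torus_shift \<alpha> ^^ (k + q)) \<omega> = (torus_shift \<alpha> ^^ q) ((torus_shift \<alpha> ^^ k) \<omega>)" for k
      by (simp add: add.commute[of k q] funpow_add)
    then show "\<exists>q>0. \<forall>k\<le>nat \<lfloor>r * real q\<rfloor>.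
        dist ((torus_shift \<alpha> ^^ k) \<omega>) ((torus_shift \<alpha> ^^ (k + q)) \<omega>) < \<epsilon>"
      using q by auto
  qed
  then show ?thesis by (simp add: GRP_def PRP_def)
qed

theorem theorem3:
  fixes \<alpha> :: "'n::finite torus"
  assumes "minimal_on UNIV (torus_shift \<alpha>)"
  shows "GRP UNIV (torus_shift \<alpha>) \<and>
    TRP UNIV (torus_shift \<alpha>) \<and>
    MRP UNIV (torus_shift \<alpha>) torus_lebesgue"
proof (intro conjI)
  show GRP: "GRP UNIV (torus_shift \<alpha>)"
    by (rule GRP_torus_shift)
  then show "TRP UNIV (torus_shift \<alpha>)"
    by (simp add: GRP_def TRP_def)
  have "measure torus_lebesgue (UNIV :: 'n torus set) = 1"
    using prob_space.prob_space[OF prob_space_torus_lebesgue[where 'n = 'n]]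
    by (simp add: torus_lebesgue_def)
  with GRP ergodic_torus_lebesgue[OF assms] show "MRP UNIV (torus_shift \<alpha>) torus_lebesgue"
    by (simp add: MRP_def GRP_def)
qed

end
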